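(* For any two convex compact sets $K,L\subset\mathbb{R}^d$ containing the origin, $$\rho_H(K^*,L^* )\le\max(\|K^*\|,\|L^*\|)^2\,\rho_H(K,L).$$
   Context: The polar of a closed convex set $K\ni0$ in $\mathbb{R}^d$ is $K^*=\{u\in\mathbb{R}^d: \langle u,x\rangle\le1\text{ for all }x\in K\}$. $\|K\|=\sup\{\|x\|:x\in K\}$ is the (possibly infinite) norm of a set, with Euclidean norm $\|x\|$. The Hausdorff distance, also used for non-compact closed sets and possibly infinite, is $\rho_H(K,L)=\inf\{\varepsilon>0: K\subset L+\varepsilon B,\ L\subset K+\varepsilon B\}$ (with $\inf\emptyset=\infty$), where $B$ is the unit Euclidean ball centred at the origin and $+$ is (closed) Minkowski addition. If a norm on the right-hand side is infinite, the right-hand side is $\infty$ for $K\ne L$ and is read as $0$ for $K=L$. *)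

theory Defs
  imports "HOL-Analysis.Analysis"
begin

definition polar :: "'a::real_inner set \<Rightarrow> 'a set" where
  "polar K = {u. \<forall>x\<in>K. u \<bullet> x \<le> 1}"

definition set_norm :: "'a::real_normed_vector set \<Rightarrow> ennreal" where
  "set_norm K = (SUP x\<in>K. ennreal (norm x))"

definition closed_sum :: "'a::real_normed_vector set \<Rightarrow> 'a set \<Rightarrow> 'a set" where
  "closed_sum A B = closure {a + b | a b. a \<in> A \<and> b \<in> B}"

(* The value is \<infinity> when no \<epsilon> qualifies, since Inf {} = \<infinity> in ennreal. *)
definition hausdorff_distance :: "'a::real_normed_vector set \<Rightarrow> 'a set \<Rightarrow> ennreal" where
  "hausdorff_distance K L =
     Inf {ennreal \<epsilon> | \<epsilon>::real. \<epsilon> > 0 \<and>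
            K \<subseteq> closed_sum L ((\<lambda>x. \<epsilon> *\<^sub>R x) ` cball 0 1) \<and>
            L \<subseteq> closed_sum K ((\<lambda>x. \<epsilon> *\<^sub>R x) ` cball 0 1)}"

(* In ennreal, \<infinity> * 0 = 0 and \<infinity> * c = \<infinity> for c > 0.  By the next two lemmas, a product
   \<infinity> * hausdorff_distance K L with K and L closed is therefore 0 if K = L and \<infinity> otherwise. *)

lemma hausdorff_distance_self: "hausdorff_distance K K = 0"
proof (rule antisym)
  show "hausdorff_distance K K \<le> 0"
  proof (rule ennreal_le_epsilon)
    fix e :: real
    assume e: "0 < e"
    have "K \<subseteq> {a + b | a b. a \<in> K \<and> b \<in> (\<lambda>x. e *\<^sub>R x) ` cball 0 1}"
      by (force intro: image_eqI [where x = 0])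
    then have "K \<subseteq> closed_sum K ((\<lambda>x. e *\<^sub>R x) ` cball 0 1)"
      unfolding closed_sum_def using closure_subset by blast
    then show "hausdorff_distance K K \<le> 0 + ennreal e"
      unfolding hausdorff_distance_def using e by (auto intro!: Inf_lower)
  qed
qed simp

lemma hausdorff_distance_eq_0_imp:
  assumes "closed K" "closed L" "hausdorff_distance K L = 0"
  shows "K = L"
proof -
  have sub: "A \<subseteq> B" if "closed B"
    and *: "\<And>e::real. e > 0 \<Longrightarrow> \<exists>d>0. d < e \<and> A \<subseteq> closed_sum B ((\<lambda>x. d *\<^sub>R x) ` cball 0 1)"
    for A B :: "'a set"
  proof
    fix x assume x: "x \<in> A"
    have "x \<in> closure B"
    proof (rule closure_approachable [THEN iffD2], intro allI impI)
      fix e :: real assume e: "e > 0"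
      then obtain d where d: "d > 0" "d < e/2" "A \<subseteq> closed_sum B ((\<lambda>x. d *\<^sub>R x) ` cball 0 1)"
        using *[of "e/2"] by auto
      with x have "x \<in> closure {a + b | a b. a \<in> B \<and> b \<in> (\<lambda>x. d *\<^sub>R x) ` cball 0 1}"
        by (auto simp: closed_sum_def)
      with e obtain y where "y \<in> {a + b | a b. a \<in> B \<and> b \<in> (\<lambda>x. d *\<^sub>R x) ` cball 0 1}"
        and y: "dist y x < e/2"
        unfolding closure_approachable by (meson half_gt_zero)
      then obtain a b where ab: "y = a + d *\<^sub>R b" "a \<in> B" "norm b \<le> 1"
        by auto
      have "dist a y \<le> d"
        using ab d by (simp add: dist_norm mult_left_le)
      then have "dist a x < e"
        using y d dist_triangle[of a x y] by linarith
      then show "\<exists>y\<in>B. dist y x < e" using ab by blast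
    qed
    then show "x \<in> B" using \<open>closed B\<close> by simp
  qed
  have "\<exists>d>0. d < e \<and> K \<subseteq> closed_sum L ((\<lambda>x. d *\<^sub>R x) ` cball 0 1) \<and>
              L \<subseteq> closed_sum K ((\<lambda>x. d *\<^sub>R x) ` cball 0 1)" if "e > 0" for e :: real
  proof -
    have "hausdorff_distance K L < ennreal e" using assms that by simp
    then show ?thesis
      unfolding hausdorff_distance_def Inf_less_iff by (auto simp: ennreal_less_iff)
  qed
  then show ?thesis using sub[of L K] sub[of K L] assms by (meson subset_antisym)
qed

end

theory Submission
  imports Defs
begin

text \<open>
  Let \<open>R\<close> be the larger of the norms of the two polars, and suppose that every point of each of
  \<open>K\<close>, \<open>L\<close> lies within distance \<open>r\<close> of the other set.  A polar vector \<open>u\<close> of \<open>K\<close> has norm at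
  most \<open>R\<close>, so passing from \<open>K\<close> to \<open>L\<close> raises its supremum from at most \<open>1\<close> to at most
  \<open>1 + r * R\<close>.  Shrinking \<open>u\<close> by this factor therefore gives a polar vector of \<open>L\<close>, and the
  displacement is at most \<open>norm u * (r * R) \<le> R\<^sup>2 * r\<close> (\<open>polar_perturbation\<close>).  One factor \<open>R\<close>
  comes from the change of the supremum, the other from the length of the vector being shrunk.

  The rest is the passage between such pointwise estimates and the Hausdorff distance
  (\<open>near_of_hausdorff_distance_less\<close>, \<open>hausdorff_distance_leI\<close>), and the degenerate values of
  \<open>R\<close>: for \<open>R = 0\<close> both polars are \<open>{0}\<close>, while for \<open>R = \<infinity>\<close> the right-hand side is infinite
  unless \<open>K = L\<close>.
\<close>

text \<open>
  The closure in \<open>closed_sum\<close> costs an arbitrarily small amount, which the gap between an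
  admissible radius and \<open>r\<close> pays for.
\<close>

lemma near_of_hausdorff_distance_less:
  fixes K L :: "'a::real_normed_vector set"
  assumes "hausdorff_distance K L < ennreal r" and "x \<in> K"
  shows "\<exists>y\<in>L. norm (x - y) \<le> r"
proof -
  obtain e where e: "e > 0" "e < r"
    and sub: "K \<subseteq> closed_sum L ((\<lambda>x. e *\<^sub>R x) ` cball 0 1)"
    using assms(1) unfolding hausdorff_distance_def Inf_less_iff by (auto simp: ennreal_less_iff)
  have "x \<in> closure {a + b | a b. a \<in> L \<and> b \<in> (\<lambda>x. e *\<^sub>R x) ` cball 0 1}"
    using sub \<open>x \<in> K\<close> by (auto simp: closed_sum_def)
  then obtain z where "z \<in> {a + b | a b. a \<in> L \<and> b \<in> (\<lambda>x. e *\<^sub>R x) ` cball 0 1}"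
    and z: "dist z x < r - e"
    using e unfolding closure_approachable by (meson diff_gt_0_iff_gt)
  then obtain a b where ab: "z = a + e *\<^sub>R b" "a \<in> L" "norm b \<le> 1"
    by auto
  have "dist a z \<le> e"
    using ab e by (simp add: dist_norm mult_left_le)
  then have "norm (x - a) \<le> r"
    using z dist_triangle[of a x z] by (simp add: dist_norm norm_minus_commute)
  with ab show ?thesis by blast
qed

lemma hausdorff_distance_commute: "hausdorff_distance K L = hausdorff_distance L K"
  unfolding hausdorff_distance_def by (simp add: conj_commute)

lemma subset_closed_sum_ball:
  fixes A B :: "'a::real_normed_vector set"
  assumes "e > 0" and near: "\<And>x. x \<in> A \<Longrightarrow> \<exists>y\<in>B. norm (x - y) \<le> e"
  shows "A \<subseteq> closed_sum B ((\<lambda>x. e *\<^sub>R x) ` cball 0 1)"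
proof
  fix x assume "x \<in> A"
  then obtain y where y: "y \<in> B" "norm (x - y) \<le> e"
    using near by blast
  have "x - y = e *\<^sub>R ((x - y) /\<^sub>R e)"
    using \<open>e > 0\<close> by simp
  moreover have "norm ((x - y) /\<^sub>R e) = norm (x - y) / e"
    using \<open>e > 0\<close> by (simp only: norm_scaleR) (simp add: divide_inverse mult.commute)
  then have "(x - y) /\<^sub>R e \<in> cball 0 1"
    using y \<open>e > 0\<close> by (simp only: mem_cball_0) simp
  ultimately have "x - y \<in> (\<lambda>x. e *\<^sub>R x) ` cball 0 1"
    by (rule image_eqI)
  moreover have "x = y + (x - y)" by simp
  ultimately have "x \<in> {a + b | a b. a \<in> B \<and> b \<in> (\<lambda>x. e *\<^sub>R x) ` cball 0 1}"
    using y by blast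
  then show "x \<in> closed_sum B ((\<lambda>x. e *\<^sub>R x) ` cball 0 1)"
    unfolding closed_sum_def by (rule subsetD[OF closure_subset])
qed

lemma hausdorff_distance_leI:
  fixes A B :: "'a::real_normed_vector set"
  assumes "r \<ge> 0"
    and AB: "\<And>x. x \<in> A \<Longrightarrow> \<exists>y\<in>B. norm (x - y) \<le> r"
    and BA: "\<And>x. x \<in> B \<Longrightarrow> \<exists>y\<in>A. norm (x - y) \<le> r"
  shows "hausdorff_distance A B \<le> ennreal r"
proof (rule ennreal_le_epsilon)
  \<comment> \<open>Only positive radii are admissible in the infimum, so \<open>r = 0\<close> has to be approached from above.\<close>
  fix e :: real assume "e > 0"
  have "A \<subseteq> closed_sum B ((\<lambda>x. (r + e) *\<^sub>R x) ` cball 0 1)"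
    by (rule subset_closed_sum_ball) (use assms \<open>e > 0\<close> in \<open>force dest: AB\<close>)+
  moreover have "B \<subseteq> closed_sum A ((\<lambda>x. (r + e) *\<^sub>R x) ` cball 0 1)"
    by (rule subset_closed_sum_ball) (use assms \<open>e > 0\<close> in \<open>force dest: BA\<close>)+
  ultimately have "hausdorff_distance A B \<le> ennreal (r + e)"
    unfolding hausdorff_distance_def using \<open>r \<ge> 0\<close> \<open>e > 0\<close> 
    by (intro Inf_lower CollectI exI[of _ "r + e"]) simp
  then show "hausdorff_distance A B \<le> ennreal r + ennreal e"
    using \<open>r \<ge> 0\<close> \<open>e > 0\<close> by simp
qed

text \<open>
  The witness is \<open>u\<close> divided by \<open>1 + r * R\<close>, a bound for \<open>\<lambda>x. u \<bullet> x\<close> on \<open>L\<close>.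
\<close>

lemma polar_perturbation:
  fixes K L :: "'a::real_inner set"
  assumes u: "u \<in> polar K" "norm u \<le> R" and "r \<ge> 0"
    and near: "\<And>x. x \<in> L \<Longrightarrow> \<exists>y\<in>K. norm (x - y) \<le> r"
  shows "\<exists>v\<in>polar L. norm (u - v) \<le> R\<^sup>2 * r"
proof -
  have R: "R \<ge> 0" using u(2) norm_ge_zero[of u] by linarith
  define c where "c = 1 + r * R"
  have c: "c \<ge> 1" unfolding c_def using R \<open>r \<ge> 0\<close> by simp
  have bound: "u \<bullet> x \<le> c" if "x \<in> L" for x
  proof -
    obtain y where y: "y \<in> K" "norm (x - y) \<le> r"
      using near \<open>x \<in> L\<close> by blast
    have "u \<bullet> x = u \<bullet> y + u \<bullet> (x - y)"
      by (simp add: inner_diff_right)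
    also have "\<dots> \<le> 1 + norm u * norm (x - y)"
    proof (rule add_mono)
      show "u \<bullet> y \<le> 1" using u(1) y(1) by (simp add: polar_def)
    qed (rule norm_cauchy_schwarz)
    also have "\<dots> \<le> c"
      unfolding c_def using mult_mono[OF u(2) y(2) R norm_ge_zero] by (simp add: mult.commute)
    finally show ?thesis .
  qed
  have "u /\<^sub>R c \<in> polar L"
    using bound c by (simp add: polar_def field_simps)
  moreover have "norm (u - u /\<^sub>R c) \<le> R\<^sup>2 * r"
  proof -
    have "u - u /\<^sub>R c = (1 - 1 / c) *\<^sub>R u"
      by (simp add: scaleR_diff_left inverse_eq_divide)
    then have "norm (u - u /\<^sub>R c) = (1 - 1 / c) * norm u"
      using c by simp
    \<comment> \<open>The factor \<open>(c - 1) / c\<close> is bounded by \<open>c - 1 = r * R\<close>, as \<open>c \<ge> 1\<close>.\<close>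
    also have "\<dots> \<le> (r * R) * R"
    proof (rule mult_mono)
      have "1 - 1 / c = (c - 1) / c"
        using c by (simp add: field_simps)
      also have "\<dots> \<le> c - 1"
        using c mult_left_mono[of 1 c "c - 1"] by (simp add: divide_le_eq)
      finally show "1 - 1 / c \<le> r * R"
        by (simp add: c_def)
    qed (simp_all add: u R \<open>r \<ge> 0\<close>)
    finally show ?thesis
      by (simp add: power2_eq_square mult_ac)
  qed
  ultimately show ?thesis by (rule bexI[rotated])
qed

lemma norm_le_set_norm: "x \<in> A \<Longrightarrow> ennreal (norm x) \<le> set_norm A"
  unfolding set_norm_def by (rule SUP_upper)

text \<open>
  Closedness enters through the case of an unbounded polar: there the right-hand side is
  \<open>\<infinity> * 0 = 0\<close> if the distance vanishes, and the distance then has to force \<open>K = L\<close>.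
\<close>

lemma hausdorff_distance_polar_le:
  fixes K L :: "'a::real_inner set"
  assumes "closed K" and "closed L"
  shows "hausdorff_distance (polar K) (polar L)
           \<le> (max (set_norm (polar K)) (set_norm (polar L)))\<^sup>2 * hausdorff_distance K L"
proof -
  define M where "M = max (set_norm (polar K)) (set_norm (polar L))"
  let ?H = "hausdorff_distance (polar K) (polar L)"
  have "?H \<le> M\<^sup>2 * hausdorff_distance K L"
  proof (cases M)
    case top
    show ?thesis
    proof (cases "hausdorff_distance K L = 0")
      case True
      then have "K = L" using assms hausdorff_distance_eq_0_imp by blast
      then show ?thesis by (simp add: hausdorff_distance_self)
    next
      case False
      then show ?thesis by (simp add: top power2_eq_square ennreal_top_mult)
    qed
  next
    case (real R)
    have R: "norm u \<le> R" if "u \<in> polar K \<union> polar L" for u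
    proof -
      have "ennreal (norm u) \<le> M"
        using that norm_le_set_norm[of u] unfolding M_def by (auto simp: le_max_iff_disj)
      then show ?thesis using real by simp
    qed
    have step: "?H \<le> ennreal (R\<^sup>2 * r)" if "hausdorff_distance K L < ennreal r" for r
    proof -
      have "r \<ge> 0"
        using that by (cases "r \<ge> 0") (auto simp: ennreal_neg)
      then show ?thesis
        using near_of_hausdorff_distance_less[OF that]
          near_of_hausdorff_distance_less[OF that[unfolded hausdorff_distance_commute[of K L]]] R
        by (intro hausdorff_distance_leI polar_perturbation) auto
    qed
    show ?thesis
    proof (cases "R = 0")
      case True
      \<comment> \<open>The bound cannot come from \<open>step\<close>, which is void if the distance of \<open>K\<close> and \<open>L\<close> is infinite.\<close>
      have "polar K \<subseteq> {0}" "polar L \<subseteq> {0}"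
        using R True by auto
      moreover have "0 \<in> polar K" "0 \<in> polar L"
        by (auto simp: polar_def)
      ultimately have "polar K = polar L" by blast
      then show ?thesis by (simp add: hausdorff_distance_self)
    next
      case False
      then have pos: "0 < ennreal (R\<^sup>2)" by simp
      have "?H / ennreal (R\<^sup>2) \<le> hausdorff_distance K L"
      proof (rule dense_ge)
        fix s assume s: "hausdorff_distance K L < s"
        have "?H \<le> ennreal (R\<^sup>2) * s"
        proof (cases s)
          case (real r)
          then show ?thesis using step[of r] s by (simp add: ennreal_mult)
        next
          case top
          then show ?thesis using pos by (simp add: ennreal_mult_top)
        qed
        then show "?H / ennreal (R\<^sup>2) \<le> s"
          using pos by (simp add: divide_le_posI_ennreal)
      qed
      then have "ennreal (R\<^sup>2) * (?H / ennreal (R\<^sup>2)) \<le> ennreal (R\<^sup>2) * hausdorff_distance K L"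
        by (rule mult_left_mono) simp
      moreover have "ennreal (R\<^sup>2) * (?H / ennreal (R\<^sup>2)) = ?H"
        unfolding ennreal_times_divide mult.commute[of "ennreal (R\<^sup>2)"]
        using pos by (intro mult_divide_eq_ennreal) auto
      ultimately have "?H \<le> ennreal (R\<^sup>2) * hausdorff_distance K L"
        by simp
      then show ?thesis using real by (simp add: ennreal_power)
    qed
  qed
  then show ?thesis unfolding M_def .
qed

theorem theorem4p2:
  fixes K L :: "(real ^ 'd) set"
  assumes "convex K" and "compact K" and "0 \<in> K"
    and "convex L" and "compact L" and "0 \<in> L"
  shows "hausdorff_distance (polar K) (polar L)
           \<le> (max (set_norm (polar K)) (set_norm (polar L)))\<^sup>2 * hausdorff_distance K L"
  by (rule hausdorff_distance_polar_le[OF compact_imp_closed compact_imp_closed, OF assms(2,5)])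

end
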